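(* Every co-chordal graph is levelable.
   Context: All graphs are finite and simple. A graph is chordal if all of its induced cycles have length three (in particular trees are chordal). A graph $G$ is co-chordal if its complement graph $G^c$ (same vertex set, with two distinct vertices adjacent in $G^c$ exactly when they are not adjacent in $G$) is chordal. A graph $G$ on $\{x_1,\ldots,x_n\}$ is levelable if there exist positive integers $c_1,\ldots,c_n$ and a constant $c$ such that $\sum_{x_i\in W}c_i=c$ for every maximal (under inclusion) independent set $W$ of $G$. *)

theory Defs
  imports Main
begin

definition finite_simple_graph :: "'a set \<Rightarrow> 'a set set \<Rightarrow> bool" where
  "finite_simple_graph V E \<longleftrightarrow> finite V \<and> (\<forall>e\<in>E. e \<subseteq> V \<and> card e = 2)"

definition complement_edges :: "'a set \<Rightarrow> 'a set set \<Rightarrow> 'a set set" where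
  "complement_edges V E = {{u, v} | u v. u \<in> V \<and> v \<in> V \<and> u \<noteq> v \<and> {u, v} \<notin> E}"

definition induced_edges :: "'a set set \<Rightarrow> 'a set \<Rightarrow> 'a set set" where
  "induced_edges E W = {e \<in> E. e \<subseteq> W}"

text \<open>A cycle is given by a list of its distinct vertices in cyclic order.\<close>

definition cycle_edges :: "'a list \<Rightarrow> 'a set set" where
  "cycle_edges vs = {{vs ! i, vs ! (Suc i mod length vs)} | i. i < length vs}"

definition induced_cycle :: "'a set \<Rightarrow> 'a set set \<Rightarrow> 'a list \<Rightarrow> bool" where
  "induced_cycle V E vs \<longleftrightarrow>
     3 \<le> length vs \<and> distinct vs \<and> set vs \<subseteq> V \<and>
     induced_edges E (set vs) = cycle_edges vs"

definition chordal :: "'a set \<Rightarrow> 'a set set \<Rightarrow> bool" where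
  "chordal V E \<longleftrightarrow> (\<forall>vs. induced_cycle V E vs \<longrightarrow> length vs = 3)"

definition co_chordal :: "'a set \<Rightarrow> 'a set set \<Rightarrow> bool" where
  "co_chordal V E \<longleftrightarrow> chordal V (complement_edges V E)"

definition independent_set :: "'a set \<Rightarrow> 'a set set \<Rightarrow> 'a set \<Rightarrow> bool" where
  "independent_set V E W \<longleftrightarrow> W \<subseteq> V \<and> (\<forall>u\<in>W. \<forall>v\<in>W. {u, v} \<notin> E)"

definition maximal_independent_set :: "'a set \<Rightarrow> 'a set set \<Rightarrow> 'a set \<Rightarrow> bool" where
  "maximal_independent_set V E W \<longleftrightarrow>
     independent_set V E W \<and> (\<forall>W'. independent_set V E W' \<and> W \<subseteq> W' \<longrightarrow> W' = W)"

definition levelable :: "'a set \<Rightarrow> 'a set set \<Rightarrow> bool" where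
  "levelable V E \<longleftrightarrow>
     (\<exists>(c :: 'a \<Rightarrow> int) (s :: int). (\<forall>x\<in>V. 0 < c x) \<and>
        (\<forall>W. maximal_independent_set V E W \<longrightarrow> (\<Sum>x\<in>W. c x) = s))"

end

(* Independent sets of G are cliques of the chordal graph complementary to G, so one needs positive
   weights under which all maximal cliques of a chordal graph weigh the same.  If the graph is not
   complete, it has a leaf clique: a maximal clique S + T in which every vertex of T has all its
   neighbours in S + T, while S + q is a clique for some q outside S + T.  By induction, delete T
   and find weights on the rest with common clique weight s; since S extends properly, it weighs
   less than s.  Scale all weights by |T| and give each vertex of T the deficit s - weight(S).
   To find a leaf clique, take an inclusion-maximal connected set M that does not dominate the
   graph.  Its neighbourhood S is completely joined to the set B of undominated vertices; by
   chordality S is a clique and some vertex of M is adjacent to all of S.  If B is a clique then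
   S + B is a leaf clique, and otherwise a leaf clique of B together with S is one. *)
theory Submission
  imports Defs
begin

section \<open>Reachability and connected sets for an abstract adjacency relation\<close>

locale sym_irrefl =
  fixes R :: "'a \<Rightarrow> 'a \<Rightarrow> bool"
  assumes sym: "R x y \<Longrightarrow> R y x"
    and irrefl: "\<not> R x x"
begin

text \<open>Both ends of every step must lie in \<open>X\<close>, but the closure is reflexive
  everywhere, so a vertex outside \<open>X\<close> reaches exactly itself.\<close>

definition reach :: "'a set \<Rightarrow> 'a \<Rightarrow> 'a \<Rightarrow> bool" where
  "reach X = (\<lambda>a b. a \<in> X \<and> b \<in> X \<and> R a b)\<^sup>*\<^sup>*"

definition conn :: "'a set \<Rightarrow> bool" where
  "conn X \<longleftrightarrow> (\<forall>x\<in>X. \<forall>y\<in>X. reach X x y)"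

lemma reach_refl: "reach X x x"
  by (simp add: reach_def)

lemma reach_trans: "reach X x y \<Longrightarrow> reach X y z \<Longrightarrow> reach X x z"
  by (simp add: reach_def)

lemma reach_edge: "x \<in> X \<Longrightarrow> y \<in> X \<Longrightarrow> R x y \<Longrightarrow> reach X x y"
  by (auto simp: reach_def)

lemma reach_sym: "reach X x y \<Longrightarrow> reach X y x"
  unfolding reach_def
  by (induction rule: rtranclp_induct) (auto intro: converse_rtranclp_into_rtranclp sym)

lemma reach_induct [consumes 1, case_names base step]:
  assumes "reach X x y" "P x"
    and "\<And>y z. reach X x y \<Longrightarrow> y \<in> X \<Longrightarrow> z \<in> X \<Longrightarrow> R y z \<Longrightarrow> P y \<Longrightarrow> P z"
  shows "P y"
  using assms unfolding reach_def by (induction rule: rtranclp_induct) auto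

lemma reach_mono: "X \<subseteq> Y \<Longrightarrow> reach X x y \<Longrightarrow> reach Y x y"
  unfolding reach_def by (erule rtranclp_mono[THEN predicate2D, rotated]) auto

lemma conn_insert:
  assumes "conn M" "m \<in> M" "R s m"
  shows "conn (insert s M)"
proof -
  have "reach (insert s M) x m" if "x \<in> insert s M" for x
    using that assms reach_mono[of M "insert s M"] reach_edge[of s "insert s M" m]
    by (auto simp: conn_def)
  then show ?thesis
    unfolding conn_def by (meson reach_sym reach_trans)
qed

text \<open>All vertices on a path in \<open>X\<close> that starts at \<open>m\<close> are reachable
  from \<open>m\<close>, so the path survives the restriction to the component.\<close>

lemma conn_component: "conn {d. reach X m d}"
proof -
  let ?D = "{d. reach X m d}"
  have "reach ?D m d" if "reach X m d" for d
    using that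
  proof (induction rule: reach_induct)
    case base
    then show ?case by (simp add: reach_refl)
  next
    case (step y z)
    then have "reach X m z" by (blast intro: reach_trans reach_edge)
    then have "reach ?D y z"
      using step by (intro reach_edge) auto
    then show ?case using step.IH by (rule reach_trans[rotated])
  qed
  then show ?thesis
    unfolding conn_def by (metis mem_Collect_eq reach_sym reach_trans)
qed

section \<open>Chordless paths\<close>

fun induced_path :: "'a list \<Rightarrow> bool" where
  "induced_path [] \<longleftrightarrow> True"
| "induced_path [x] \<longleftrightarrow> True"
| "induced_path (x # y # zs) \<longleftrightarrow>
     R x y \<and> x \<noteq> y \<and> (\<forall>z\<in>set zs. x \<noteq> z \<and> \<not> R x z) \<and> induced_path (y # zs)"

lemma induced_path_tl: "induced_path (x # xs) \<Longrightarrow> induced_path xs"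
  by (cases xs) auto

lemma induced_path_suffix: "induced_path (as @ bs) \<Longrightarrow> induced_path bs"
  by (induction as) (auto dest: induced_path_tl)

lemma induced_path_distinct: "induced_path xs \<Longrightarrow> distinct xs"
  by (induction xs rule: induced_path.induct) auto

lemma induced_path_nth:
  "induced_path xs \<Longrightarrow> i < j \<Longrightarrow> j < length xs \<Longrightarrow> R (xs ! i) (xs ! j) \<longleftrightarrow> j = Suc i"
proof (induction xs arbitrary: i j rule: induced_path.induct)
  case (3 x y zs)
  from 3(3) obtain j' where j: "j = Suc j'" by (cases j) auto
  show ?case
  proof (cases i)
    case 0
    then show ?thesis using 3 j by (cases j') auto
  next
    case (Suc i')
    then show ?thesis using 3 j by simp
  qed
qed auto

text \<open>Cut the path just before the last neighbour of \<open>u\<close>: on the remaining suffix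
  \<open>u\<close> sees only the first vertex, so \<open>u\<close> can be put in front without a
  chord.\<close>

lemma induced_path_extend:
  assumes "induced_path xs" "u \<notin> set xs" "\<exists>z\<in>set xs. R u z"
  shows "\<exists>ys. ys \<noteq> [] \<and> induced_path (u # ys) \<and> last ys = last xs \<and> set ys \<subseteq> set xs"
  using assms
proof (induction xs)
  case (Cons x xs)
  show ?case
  proof (cases "\<exists>z\<in>set xs. R u z")
    case True
    then have "xs \<noteq> []" by auto
    then show ?thesis
      using Cons.IH True Cons.prems induced_path_tl[of x xs] by fastforce
  next
    case False
    then show ?thesis
      using Cons.prems by (intro exI[of _ "x # xs"]) auto
  qed
qed simp

text \<open>The path is built backwards from \<open>v\<close>. A new vertex already on the path cuts
  it at that place; any other one is put in front, with a shortcut to its last neighbour.\<close>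

lemma reach_induced_path:
  assumes "reach X u v" "v \<in> X"
  shows "\<exists>xs. xs \<noteq> [] \<and> hd xs = u \<and> last xs = v \<and> set xs \<subseteq> X \<and> induced_path xs"
  using assms(1) unfolding reach_def
proof (induction rule: converse_rtranclp_induct)
  case base
  then show ?case using assms by (intro exI[of _ "[v]"]) auto
next
  case (step u y)
  then obtain xs where xs: "xs \<noteq> []" "hd xs = y" "last xs = v" "set xs \<subseteq> X" "induced_path xs"
    by blast
  show ?case
  proof (cases "u \<in> set xs")
    case True
    then obtain as bs where "xs = as @ u # bs" by (meson split_list)
    then show ?thesis
      using xs induced_path_suffix[of as "u # bs"] by (intro exI[of _ "u # bs"]) auto
  next
    case False
    moreover have "\<exists>z\<in>set xs. R u z" using xs step by (metis hd_in_set)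
    ultimately obtain ys where
      "ys \<noteq> []" "induced_path (u # ys)" "last ys = last xs" "set ys \<subseteq> set xs"
      using induced_path_extend xs by blast
    then show ?thesis
      using xs step by (intro exI[of _ "u # ys"]) auto
  qed
qed

section \<open>Cliques and the existence of a leaf clique\<close>

definition clique :: "'a set \<Rightarrow> bool" where
  "clique K \<longleftrightarrow> (\<forall>x\<in>K. \<forall>y\<in>K. x \<noteq> y \<longrightarrow> R x y)"

text \<open>In this form chordality is used without mentioning cycles: a violation yields an induced
  cycle through w, u, D and v.\<close>

definition hole_free :: "'a set \<Rightarrow> bool" where
  "hole_free X \<longleftrightarrow> (\<forall>D u v w. D \<subseteq> X \<longrightarrow> u \<in> X \<longrightarrow> v \<in> X \<longrightarrow> w \<in> X \<longrightarrow> conn D \<longrightarrow>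
     w \<notin> D \<longrightarrow> (\<forall>d\<in>D. \<not> R w d) \<longrightarrow> R w u \<longrightarrow> R w v \<longrightarrow>
     (\<exists>d\<in>D. R u d) \<longrightarrow> (\<exists>d\<in>D. R v d) \<longrightarrow> u \<noteq> v \<longrightarrow> R u v)"

lemma hole_free_subset: "hole_free X \<Longrightarrow> Y \<subseteq> X \<Longrightarrow> hole_free Y"
  unfolding hole_free_def by (meson subset_iff)

lemma hole_freeD:
  assumes "hole_free X" "D \<subseteq> X" "u \<in> X" "v \<in> X" "w \<in> X" "conn D" "w \<notin> D"
    "\<And>d. d \<in> D \<Longrightarrow> \<not> R w d" "R w u" "R w v" "d \<in> D" "R u d" "e \<in> D" "R v e" "u \<noteq> v"
  shows "R u v"
  using assms unfolding hole_free_def by blast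

text \<open>If \<open>m\<close> serves \<open>S\<close> but misses \<open>s\<close>, let
  \<open>D\<close> be the component of \<open>m\<close> among the vertices of \<open>M\<close> not
  adjacent to \<open>s\<close>. As \<open>M\<close> is connected and contains a neighbour of
  \<open>s\<close>, some edge leaves \<open>D\<close> towards a neighbour \<open>q\<close> of
  \<open>s\<close>. Hole-freeness then makes \<open>q\<close> adjacent to all of
  \<open>S\<close>.\<close>

lemma common_neighbour:
  assumes hf: "hole_free X" and M: "M \<subseteq> X" "conn M" "M \<noteq> {}"
    and "finite S" "S \<subseteq> X" "S \<inter> M = {}" "clique S" "\<forall>s\<in>S. \<exists>m\<in>M. R s m"
  shows "\<exists>m\<in>M. \<forall>s\<in>S. R m s"
  using assms(5-)
proof (induction S rule: finite_induct)
  case empty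
  then show ?case using M by auto
next
  case (insert s S)
  then obtain m where m: "m \<in> M" "\<forall>t\<in>S. R m t"
    by (auto simp: clique_def)
  show ?case
  proof (cases "R m s")
    case True
    then show ?thesis using m by auto
  next
    case False
    define N where "N = {x \<in> M. \<not> R s x}"
    define D where "D = {d. reach N m d}"
    have DN: "D \<subseteq> N"
    proof
      fix d assume "d \<in> D"
      then have "reach N m d" by (simp add: D_def)
      moreover have "m \<in> N" using m False sym by (auto simp: N_def)
      ultimately show "d \<in> N"
        by (induction rule: reach_induct) auto
    qed
    have mD: "m \<in> D" by (simp add: D_def reach_refl)
    obtain z where z: "z \<in> M" "R s z" using insert.prems by auto
    have "reach M m z" using M m z by (auto simp: conn_def)
    \<comment> \<open>Follow a path in \<open>M\<close> from \<open>m\<close>: it stays in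
      \<open>D\<close> until it first meets a neighbour of \<open>s\<close>, which is then the
      desired \<open>q\<close>.\<close>
    then have "z \<in> D \<or> (\<exists>d\<in>D. \<exists>q\<in>M. R d q \<and> R s q)"
    proof (induction rule: reach_induct)
      case base
      then show ?case using mD by simp
    next
      case (step y z)
      have "z \<in> D" if "y \<in> D" "\<not> R s z"
      proof -
        have "reach N y z" using that step DN by (intro reach_edge) (auto simp: N_def)
        then show ?thesis using that by (auto simp: D_def intro: reach_trans)
      qed
      then show ?case using step by blast
    qed
    then obtain d q where q: "d \<in> D" "q \<in> M" "R d q" "R s q"
      using z DN by (auto simp: N_def)
    \<comment> \<open>The apex is \<open>s\<close>: it sees \<open>q\<close> and \<open>t\<close>
      but nothing in \<open>D\<close>, while \<open>q\<close> touches \<open>D\<close> at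
      \<open>d\<close> and \<open>t\<close> touches it at \<open>m\<close>.\<close>
    have "R q t" if "t \<in> S" for t
    proof (rule hole_freeD[OF hf, where D = D and w = s and d = d and e = m])
      show "conn D" unfolding D_def by (rule conn_component)
      show "R s t" "s \<in> X" "t \<in> X" "q \<noteq> t" "s \<notin> D" "q \<in> X" "D \<subseteq> X"
        using that insert q M DN by (auto simp: clique_def N_def)
      show "R q d" "R t m" "d \<in> D" "m \<in> D" "R s q" using q m that sym mD by auto
      show "\<not> R s x" if "x \<in> D" for x using that DN by (auto simp: N_def)
    qed
    then show ?thesis using q sym by auto
  qed
qed

lemma leaf_clique:
  assumes "finite X" "hole_free X" "\<not> clique X"
  shows "\<exists>S T q. T \<noteq> {} \<and> S \<inter> T = {} \<and> S \<union> T \<subseteq> X \<and> clique (S \<union> T) \<and>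
     (\<forall>t\<in>T. \<forall>x\<in>X. R t x \<longrightarrow> x \<in> S \<union> T) \<and> q \<in> X - (S \<union> T) \<and> clique (insert q S)"
  using assms
proof (induction X rule: finite_psubset_induct)
  case (psubset X)
  define undom where "undom M = {x \<in> X - M. \<forall>m\<in>M. \<not> R x m}" for M
  define good where "good M \<longleftrightarrow> M \<subseteq> X \<and> M \<noteq> {} \<and> conn M \<and> undom M \<noteq> {}" for M
  obtain a b where ab: "a \<in> X" "b \<in> X" "a \<noteq> b" "\<not> R a b"
    using psubset.prems by (auto simp: clique_def)
  \<comment> \<open>A single vertex is connected, and \<open>b\<close> is not dominated by
    \<open>a\<close>.\<close>
  then have "good {a}" using sym by (auto simp: good_def undom_def conn_def reach_refl)
  moreover have "finite {M. good M}"
    using psubset.hyps by (rule_tac finite_subset[of _ "Pow X"]) (auto simp: good_def)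
  ultimately obtain M where M: "good M" and max: "\<And>M'. good M' \<Longrightarrow> M \<subseteq> M' \<Longrightarrow> M = M'"
    using finite_has_maximal[of "{M. good M}"] by auto
  define B where "B = undom M"
  define S where "S = X - M - B"
  have M': "M \<subseteq> X" "M \<noteq> {}" "conn M" and B: "B \<noteq> {}" "B \<subseteq> X - M"
    using M by (auto simp: good_def B_def undom_def)
  have Snb: "\<exists>m\<in>M. R s m" if "s \<in> S" for s
    using that by (auto simp: S_def B_def undom_def)
  have BM: "\<not> R b m" if "b \<in> B" "m \<in> M" for b m
    using that by (auto simp: B_def undom_def)
  have SB: "R s b" if "s \<in> S" "b \<in> B" for s b
  proof (rule ccontr)
    assume "\<not> R s b"
    \<comment> \<open>Adding \<open>s\<close> to \<open>M\<close> would keep it connected and leave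
      \<open>b\<close> undominated, against maximality.\<close>
    then have "b \<in> undom (insert s M)"
      using that sym by (auto simp: B_def S_def undom_def)
    moreover have "conn (insert s M)"
      using Snb[OF that(1)] M' conn_insert by blast
    ultimately have "good (insert s M)"
      using M' that by (auto simp: good_def S_def)
    then show False using max[of "insert s M"] that by (auto simp: S_def)
  qed
  have S: "clique S"
    unfolding clique_def
  proof (intro ballI impI)
    fix s t assume st: "s \<in> S" "t \<in> S" "s \<noteq> t"
    \<comment> \<open>The apex is an undominated \<open>b\<close>: it is joined to all of
      \<open>S\<close> and misses the connected set \<open>M\<close>, in which both \<open>s\<close>
      and \<open>t\<close> have neighbours.\<close>
    obtain b where b: "b \<in> B" using B by auto
    obtain d e where "d \<in> M" "R s d" "e \<in> M" "R t e" using Snb st by blast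
    then show "R s t"
      using st b B M' BM SB sym
      by (intro hole_freeD[OF psubset.prems(1), of M s t b d e]) (auto simp: S_def)
  qed
  show ?case
  proof (cases "clique B")
    case True
    obtain q where q: "q \<in> M" "\<forall>s\<in>S. R q s"
      using common_neighbour[OF psubset.prems(1) M'(1,3,2), of S] S Snb psubset.hyps
      by (auto simp: S_def)
    have "clique (S \<union> B)" "clique (insert q S)"
      using S True SB sym q by (auto simp: clique_def)
    moreover have "\<forall>t\<in>B. \<forall>x\<in>X. R t x \<longrightarrow> x \<in> S \<union> B"
      using BM by (auto simp: S_def)
    moreover have "S \<inter> B = {}" "S \<union> B \<subseteq> X" "q \<in> X - (S \<union> B)"
      using B q M' by (auto simp: S_def)
    ultimately show ?thesis
      using B(1) by blast
  next
    case False
    have "B \<subset> X" using B M' by auto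
    then obtain S1 T q where *: "T \<noteq> {}" "S1 \<inter> T = {}" "S1 \<union> T \<subseteq> B" "clique (S1 \<union> T)"
      "\<forall>t\<in>T. \<forall>x\<in>B. R t x \<longrightarrow> x \<in> S1 \<union> T" "q \<in> B - (S1 \<union> T)" "clique (insert q S1)"
      using psubset.IH[of B] hole_free_subset[OF psubset.prems(1)] False
      by (metis psubset_imp_subset)
    \<comment> \<open>A leaf clique of \<open>B\<close> may be enlarged by all of \<open>S\<close>.
      Vertices of \<open>T\<close> gain no further neighbours in \<open>X\<close>, since
      \<open>B\<close> has no edges to \<open>M\<close>.\<close>
    have join: "clique (S \<union> K)" if "K \<subseteq> B" "clique K" for K
      using that S SB sym unfolding clique_def by blast
    have "clique ((S \<union> S1) \<union> T)" "clique (insert q (S \<union> S1))"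
      using join[of "S1 \<union> T"] join[of "insert q S1"] * by (auto simp: Un_assoc)
    moreover have "\<forall>t\<in>T. \<forall>x\<in>X. R t x \<longrightarrow> x \<in> (S \<union> S1) \<union> T"
      using BM * unfolding S_def by blast
    moreover have "(S \<union> S1) \<inter> T = {}" "(S \<union> S1) \<union> T \<subseteq> X" "q \<in> X - ((S \<union> S1) \<union> T)"
      using * B unfolding S_def by blast+
    ultimately show ?thesis
      using *(1) by blast
  qed
qed

section \<open>Positive weights that are equal on all maximal cliques\<close>

definition max_clique :: "'a set \<Rightarrow> 'a set \<Rightarrow> bool" where
  "max_clique X K \<longleftrightarrow>
     K \<subseteq> X \<and> clique K \<and> (\<forall>K'. K' \<subseteq> X \<and> clique K' \<and> K \<subseteq> K' \<longrightarrow> K' = K)"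

lemma clique_extend:
  assumes "finite X" "K \<subseteq> X" "clique K"
  obtains Q where "max_clique X Q" "K \<subseteq> Q"
proof -
  have "finite {Q. Q \<subseteq> X \<and> clique Q}" using assms by simp
  then obtain Q where "Q \<subseteq> X" "clique Q" "K \<subseteq> Q"
    "\<forall>Q'\<in>{Q. Q \<subseteq> X \<and> clique Q}. Q \<subseteq> Q' \<longrightarrow> Q = Q'"
    using assms finite_has_maximal2[of "{Q. Q \<subseteq> X \<and> clique Q}" K] by auto
  then show thesis by (intro that) (auto simp: max_clique_def)
qed

lemma uniform_clique_weights:
  assumes "finite X" "hole_free X"
  shows "\<exists>(c :: 'a \<Rightarrow> int) s. (\<forall>x\<in>X. 0 < c x) \<and> (\<forall>W. max_clique X W \<longrightarrow> sum c W = s)"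
  using assms
proof (induction X rule: finite_psubset_induct)
  case (psubset X)
  show ?case
  proof (cases "clique X")
    case True
    then have "W = X" if "max_clique X W" for W
      using that by (auto simp: max_clique_def)
    then show ?thesis by (intro exI[of _ "\<lambda>_. 1"] exI[of _ "int (card X)"]) auto
  next
    case False
    obtain S T q where leaf: "T \<noteq> {}" "S \<inter> T = {}" "S \<union> T \<subseteq> X" "clique (S \<union> T)"
      "\<forall>t\<in>T. \<forall>x\<in>X. R t x \<longrightarrow> x \<in> S \<union> T" "q \<in> X - (S \<union> T)" "clique (insert q S)"
      using leaf_clique[OF psubset.hyps psubset.prems False] by blast
    have "X - T \<subset> X" using leaf by auto
    then obtain c :: "'a \<Rightarrow> int" and s where c: "\<forall>x\<in>X - T. 0 < c x"
      and cs: "\<And>W. max_clique (X - T) W \<Longrightarrow> sum c W = s"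
      using psubset.IH[of "X - T"] hole_free_subset[OF psubset.prems] by (metis psubset_imp_subset)
    have fin: "finite S" "finite T"
      using leaf(3) psubset.hyps by (meson finite_subset le_supE)+
    define d where "d = s - sum c S"
    have "finite (X - T)" "insert q S \<subseteq> X - T" using leaf psubset.hyps by auto
    \<comment> \<open>\<open>Q\<close> weighs \<open>s\<close> and contains \<open>S\<close> and
      also \<open>q\<close>, whose weight is positive; hence the deficit \<open>d\<close> is
      positive.\<close>
    then obtain Q where Q: "max_clique (X - T) Q" "insert q S \<subseteq> Q"
      using clique_extend leaf(7) by metis
    have "Q \<subseteq> X - T" using Q by (auto simp: max_clique_def)
    have "0 < c q" "q \<notin> S" using leaf(6) c by auto
    then have "sum c S < sum c (insert q S)"
      using fin by simp
    also have "\<dots> \<le> sum c Q"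
    proof (rule sum_mono2)
      show "finite Q" using \<open>Q \<subseteq> X - T\<close> \<open>finite (X - T)\<close> by (rule finite_subset)
      show "0 \<le> c x" if "x \<in> Q - insert q S" for x
        using that \<open>Q \<subseteq> X - T\<close> c by (meson DiffD1 less_imp_le subsetD)
    qed (rule Q)
    finally have d: "d > 0" using cs[OF Q(1)] by (simp add: d_def)
    \<comment> \<open>Instead of dividing the deficit among the vertices of \<open>T\<close>, the
      old weights are multiplied by \<open>n\<close>. Then \<open>T\<close> weighs
      \<open>n * d\<close> in total and the weights remain integers.\<close>
    define n where "n = int (card T)"
    have n: "n > 0" using leaf(1) fin by (simp add: n_def card_gt_0_iff)
    define c' where "c' x = (if x \<in> T then d else n * c x)" for x
    have c'_old: "sum c' W = n * sum c W" if "W \<inter> T = {}" for W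
    proof -
      have "sum c' W = (\<Sum>x\<in>W. n * c x)"
        using that by (intro sum.cong refl) (auto simp: c'_def)
      then show ?thesis by (simp add: sum_distrib_left)
    qed
    have "sum c' W = n * s" if W: "max_clique X W" for W
    proof (cases "W \<inter> T = {}")
      case True
      moreover have "K \<subseteq> X" if "K \<subseteq> X - T" for K using that by blast
      \<comment> \<open>Cliques of \<open>X - T\<close> are cliques of \<open>X\<close>, so
        maximality passes to the smaller set.\<close>
      ultimately have "max_clique (X - T) W"
        using W unfolding max_clique_def by (simp add: Diff_eq disjoint_eq_subset_Compl)
      then show ?thesis using cs True c'_old by simp
    next
      case False
      then obtain t where t: "t \<in> W" "t \<in> T" by blast
      \<comment> \<open>All neighbours of \<open>t\<close> lie in the clique
        \<open>S \<union> T\<close>, so a maximal clique through \<open>t\<close> must equal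
        it.\<close>
      have "W \<subseteq> S \<union> T"
      proof
        fix x assume "x \<in> W"
        then have "x \<in> X" "x = t \<or> R t x" using W t by (auto simp: max_clique_def clique_def)
        then show "x \<in> S \<union> T" using leaf(5) t by blast
      qed
      then have "W = S \<union> T" using W leaf(3,4) unfolding max_clique_def by metis
      moreover have "sum c' T = n * d" by (simp add: c'_def n_def)
      ultimately show ?thesis
        using fin leaf(2) c'_old[of S]
        by (simp add: sum.union_disjoint d_def algebra_simps)
    qed
    moreover have "\<forall>x\<in>X. 0 < c' x" using c d n by (auto simp: c'_def)
    ultimately show ?thesis by blast
  qed
qed

end

section \<open>From chordality to hole-freeness\<close>

lemma induced_cycle_Cons:
  assumes "sym_irrefl (\<lambda>u v. {u, v} \<in> E)" and E: "\<And>e. e \<in> E \<Longrightarrow> card e = 2"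
    and path: "sym_irrefl.induced_path (\<lambda>u v. {u, v} \<in> E) xs" "2 \<le> length xs"
    and V: "insert w (set xs) \<subseteq> V" "w \<notin> set xs"
    and w: "\<And>x. x \<in> set xs \<Longrightarrow> {w, x} \<in> E \<longleftrightarrow> x = hd xs \<or> x = last xs"
  shows "induced_cycle V E (w # xs)"
proof -
  interpret sym_irrefl "\<lambda>u v. {u, v} \<in> E" by fact
  let ?vs = "w # xs"
  let ?n = "length ?vs"
  have dist: "distinct xs" using path induced_path_distinct by blast
  have hl: "hd xs = ?vs ! 1" "last xs = ?vs ! (?n - 1)"
    using path(2) by (cases xs; auto simp: last_conv_nth nth_Cons')+
  \<comment> \<open>Edges are unordered, so index pairs with \<open>i < j\<close> suffice. The
    second alternative is the edge that closes the cycle at \<open>w\<close>.\<close>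
  have adj: "{?vs ! i, ?vs ! j} \<in> E \<longleftrightarrow> j = Suc i \<or> (i = 0 \<and> j = ?n - 1)"
    if "i < j" "j < ?n" for i j
  proof (cases i)
    case 0
    have "?vs ! j \<in> set xs" using that by (cases j) auto
    then have "{w, ?vs ! j} \<in> E \<longleftrightarrow> ?vs ! j = ?vs ! 1 \<or> ?vs ! j = ?vs ! (?n - 1)"
      using w hl by metis
    also have "\<dots> \<longleftrightarrow> j = 1 \<or> j = ?n - 1"
    proof -
      have "distinct ?vs" using dist V by simp
      then show ?thesis using that path(2)
        by (subst (1 2) nth_eq_iff_index_eq) auto
    qed
    finally show ?thesis using 0 by simp
  next
    case (Suc i')
    then obtain j' where "j = Suc j'" using \<open>i < j\<close> by (cases j) auto
    then show ?thesis using Suc that induced_path_nth[OF path(1), of i' j'] by simp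
  qed
  have "induced_edges E (set ?vs) = cycle_edges ?vs"
  proof
    show "induced_edges E (set ?vs) \<subseteq> cycle_edges ?vs"
    proof
      fix e assume "e \<in> induced_edges E (set ?vs)"
      then have e: "e \<in> E" "e \<subseteq> set ?vs" by (auto simp: induced_edges_def)
      then obtain a b where ab: "e = {a, b}" "a \<noteq> b" using E by (meson card_2_iff)
      then obtain i j where "i < ?n" "j < ?n" "a = ?vs ! i" "b = ?vs ! j"
        using e by (metis insert_subset in_set_conv_nth)
      then obtain i j where ij: "i < j" "j < ?n" "e = {?vs ! i, ?vs ! j}"
        using ab by (metis insert_commute nat_neq_iff)
      then have "j = Suc i \<or> (i = 0 \<and> j = ?n - 1)" using adj e by blast
      then show "e \<in> cycle_edges ?vs"
      proof
        assume "j = Suc i"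
        then show ?thesis using ij unfolding cycle_edges_def by (auto intro!: exI[of _ i])
      next
        assume "i = 0 \<and> j = ?n - 1"
        then have "Suc j mod ?n = i" by simp
        then have "e = {?vs ! j, ?vs ! (Suc j mod ?n)}" using ij by (simp add: insert_commute)
        then show ?thesis using ij(2) unfolding cycle_edges_def by blast
      qed
    qed
    show "cycle_edges ?vs \<subseteq> induced_edges E (set ?vs)"
    proof
      fix e assume "e \<in> cycle_edges ?vs"
      then obtain i where i: "i < ?n" "e = {?vs ! i, ?vs ! (Suc i mod ?n)}"
        unfolding cycle_edges_def by blast
      have "e \<in> E"
      proof (cases "Suc i < ?n")
        case True
        then show ?thesis using i adj[of i "Suc i"] by simp
      next
        case False
        \<comment> \<open>At the last index the successor wraps around to 0.\<close>
        then have "i = ?n - 1" using i by simp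
        then show ?thesis using i adj[of 0 "?n - 1"] path(2)
          by (cases xs) (auto simp: insert_commute)
      qed
      moreover have "?vs ! i \<in> set ?vs" "?vs ! (Suc i mod ?n) \<in> set ?vs"
        using i by (intro nth_mem; simp)+
      ultimately show "e \<in> induced_edges E (set ?vs)"
        using i by (simp add: induced_edges_def)
    qed
  qed
  then show ?thesis
    using path dist V by (auto simp: induced_cycle_def)
qed

text \<open>If \<open>u\<close> and \<open>v\<close> were not adjacent, a chordless path from
  \<open>u\<close> to \<open>v\<close> through \<open>D\<close> would have at least three vertices.
  Since \<open>w\<close> sees only its ends, \<open>w\<close> closes it to an induced cycle of
  length at least four.\<close>

lemma chordal_hole_free:
  assumes "sym_irrefl (\<lambda>u v. {u, v} \<in> E)" and E: "\<And>e. e \<in> E \<Longrightarrow> card e = 2"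
    and "chordal V E"
  shows "sym_irrefl.hole_free (\<lambda>u v. {u, v} \<in> E) V"
proof -
  interpret sym_irrefl "\<lambda>u v. {u, v} \<in> E" by fact
  show ?thesis
    unfolding hole_free_def
  proof (intro allI impI, rule ccontr)
    fix D u v w
    assume D: "D \<subseteq> V" "conn D" and mem: "u \<in> V" "v \<in> V" "w \<in> V" "w \<notin> D" "u \<noteq> v"
      and wD: "\<forall>d\<in>D. {w, d} \<notin> E" and wu: "{w, u} \<in> E" and wv: "{w, v} \<in> E"
      and "\<exists>d\<in>D. {u, d} \<in> E" "\<exists>d\<in>D. {v, d} \<in> E" and uv: "{u, v} \<notin> E"
    then obtain d e where de: "d \<in> D" "{u, d} \<in> E" "e \<in> D" "{v, e} \<in> E" by blast
    let ?X = "insert u (insert v D)"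
    have "conn ?X" by (intro conn_insert[of _ d] conn_insert[of _ e]) (use D de in auto)
    then have "reach ?X u v" by (simp add: conn_def)
    then obtain xs where xs: "xs \<noteq> []" "hd xs = u" "last xs = v" "set xs \<subseteq> ?X" "induced_path xs"
      using reach_induced_path[of ?X u v] by auto
    have w: "w \<notin> ?X" using mem wu wv irrefl by auto
    have len: "3 \<le> length xs"
    proof (rule ccontr)
      assume "\<not> 3 \<le> length xs"
      moreover have "length xs \<noteq> 0" using xs(1) by simp
      ultimately consider "length xs = 1" | "length xs = 2" by linarith
      then show False
      proof cases
        case 1
        then show False using xs mem by (auto simp: length_Suc_conv)
      next
        case 2
        then obtain a b where "xs = [a, b]" by (auto simp: length_Suc_conv numeral_2_eq_2)
        then show False using xs uv by auto
      qed
    qed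
    have "induced_cycle V E (w # xs)"
    proof (rule induced_cycle_Cons)
      show "sym_irrefl (\<lambda>u v. {u, v} \<in> E)" by fact
      show "2 \<le> length xs" using len by simp
      show "insert w (set xs) \<subseteq> V" "w \<notin> set xs" using xs mem w D by auto
      show "{w, x} \<in> E \<longleftrightarrow> x = hd xs \<or> x = last xs" if "x \<in> set xs" for x
        using that xs wD wu wv by auto
    qed (use E xs in auto)
    then show False using \<open>chordal V E\<close> len by (auto simp: chordal_def)
  qed
qed

section \<open>Maximal independent sets as maximal cliques of the complement\<close>

theorem theorem5p2:
  fixes V :: "'a set" and E :: "'a set set"
  assumes "finite_simple_graph V E"
    and "co_chordal V E"
  shows "levelable V E"
proof -
  let ?C = "complement_edges V E"
  have C: "card e = 2" if "e \<in> ?C" for e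
    using that by (auto simp: complement_edges_def)
  have adj: "{u, v} \<in> ?C \<longleftrightarrow> u \<in> V \<and> v \<in> V \<and> u \<noteq> v \<and> {u, v} \<notin> E" for u v
    by (auto simp: complement_edges_def doubleton_eq_iff insert_commute)
  have si: "sym_irrefl (\<lambda>u v. {u, v} \<in> ?C)"
    by standard (auto simp: insert_commute dest: C)
  interpret sym_irrefl "\<lambda>u v. {u, v} \<in> ?C" by (rule si)
  have loop: "{u, u} \<notin> E" for u
    using assms(1) by (auto simp: finite_simple_graph_def)
  have indep: "independent_set V E W \<longleftrightarrow> W \<subseteq> V \<and> clique W" for W
  proof -
    \<comment> \<open>Independence also tests pairs with \<open>u = v\<close>, cliques do not; the
      two agree because \<open>{u, u}\<close> has one element and is never an edge.\<close>
    have "{u, v} \<notin> E \<longleftrightarrow> (u \<noteq> v \<longrightarrow> {u, v} \<in> ?C)" if "u \<in> V" "v \<in> V" for u v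
      using that adj[of u v] loop[of u] by (cases "u = v") simp_all
    then show ?thesis
      unfolding independent_set_def clique_def by (meson subsetD)
  qed
  have "maximal_independent_set V E W \<longleftrightarrow> max_clique V W" for W
    unfolding maximal_independent_set_def max_clique_def indep by (simp only: conj_assoc)
  moreover have "finite V" using assms(1) by (simp add: finite_simple_graph_def)
  moreover have "hole_free V"
    using chordal_hole_free[OF si C] assms(2) by (simp add: co_chordal_def)
  ultimately show ?thesis
    using uniform_clique_weights unfolding levelable_def by simp
qed

end
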